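(* Let $t,n\in\mathbb{N}$ with $t\ge 3$ and $n\ge 3$. Then $$gr^t_2(B_n)\ge \begin{cases} \frac{4n+6}{3} & \text{if } n\equiv 0\pmod{3}, \\ \frac{5n+1}{3} & \text{if } n\equiv 1\pmod{3}, \\ \frac{4n+7}{3} & \text{if } n\equiv 2\pmod{3}.\end{cases}$$
   Context: $K_n$ is the complete graph of order $n$. The book $B_n:=K_2+nK_1$ (graph join) is the graph on $n+2$ vertices consisting of an edge $xy$ (the spine) together with $n$ further, pairwise non-adjacent vertices (the pages), each adjacent to both $x$ and $y$. A $t$-coloring of $K_p$ is a map $f:E(K_p)\to\{1,\dots,t\}$, not assumed surjective. A Gallai $t$-coloring is a $t$-coloring with no rainbow triangle, i.e. there are no three vertices $x,y,z$ such that $f(xy),f(xz),f(yz)$ are pairwise distinct. For $1\le s<t$ and a graph $G$, the weakened Gallai-Ramsey number $gr^t_s(G)$ is the least $p\in\mathbb{N}$ such that every Gallai $t$-coloring of $K_p$ contains a (not necessarily induced) subgraph isomorphic to $G$ whose edges use at most $s$ colors. *)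

theory Defs
  imports Complex_Main "HOL-Library.Ramsey"
begin

text \<open>Simple graphs are pairs of a vertex set and a set of two-element sets of vertices; \<open>[V]\<^bsup>2\<^esup>\<close>
  (\<open>nsets V 2\<close>) is the set of all two-element subsets of \<open>V\<close>.\<close>

record 'a ugraph =
  verts :: "'a set"
  edges :: "'a set set"

definition simple_graph :: "'a ugraph \<Rightarrow> bool" where
  "simple_graph G \<longleftrightarrow> edges G \<subseteq> [verts G]\<^bsup>2\<^esup>"

definition subgraph :: "'a ugraph \<Rightarrow> 'a ugraph \<Rightarrow> bool" where
  "subgraph H G \<longleftrightarrow> simple_graph H \<and> verts H \<subseteq> verts G \<and> edges H \<subseteq> edges G"

definition graph_iso :: "'a ugraph \<Rightarrow> 'b ugraph \<Rightarrow> bool" where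
  "graph_iso G H \<longleftrightarrow>
     (\<exists>h. bij_betw h (verts G) (verts H) \<and>
          (\<forall>x\<in>verts G. \<forall>y\<in>verts G. {x, y} \<in> edges G \<longleftrightarrow> {h x, h y} \<in> edges H))"

definition complete_graph :: "nat \<Rightarrow> nat ugraph" where
  "complete_graph p = \<lparr>verts = {..<p}, edges = [{..<p}]\<^bsup>2\<^esup>\<rparr>"

definition empty_graph :: "nat \<Rightarrow> nat ugraph" where
  "empty_graph n = \<lparr>verts = {..<n}, edges = {}\<rparr>"

definition graph_join :: "'a ugraph \<Rightarrow> 'b ugraph \<Rightarrow> ('a + 'b) ugraph" where
  "graph_join G H =
     \<lparr>verts = verts G <+> verts H,
      edges = (image Inl) ` edges G \<union> (image Inr) ` edges H
                \<union> {{Inl x, Inr y} |x y. x \<in> verts G \<and> y \<in> verts H}\<rparr>"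

definition book :: "nat \<Rightarrow> (nat + nat) ugraph" where
  "book n = graph_join (complete_graph 2) (empty_graph n)"

text \<open>Only the values of a coloring on the edges of the graph matter.\<close>

definition edge_coloring :: "nat \<Rightarrow> 'a ugraph \<Rightarrow> ('a set \<Rightarrow> nat) \<Rightarrow> bool" where
  "edge_coloring t G f \<longleftrightarrow> f \<in> edges G \<rightarrow> {1..t}"

definition rainbow_triangle :: "'a ugraph \<Rightarrow> ('a set \<Rightarrow> nat) \<Rightarrow> 'a \<Rightarrow> 'a \<Rightarrow> 'a \<Rightarrow> bool" where
  "rainbow_triangle G f x y z \<longleftrightarrow>
     {{x, y}, {x, z}, {y, z}} \<subseteq> edges G \<and> distinct [x, y, z] \<and>
     distinct [f {x, y}, f {x, z}, f {y, z}]"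

definition gallai_coloring :: "nat \<Rightarrow> 'a ugraph \<Rightarrow> ('a set \<Rightarrow> nat) \<Rightarrow> bool" where
  "gallai_coloring t G f \<longleftrightarrow>
     edge_coloring t G f \<and> (\<nexists>x y z. rainbow_triangle G f x y z)"

text \<open>For a finite simple graph \<open>G\<close> and \<open>1 \<le> s\<close> the set of admissible \<open>p\<close> is nonempty by Ramsey's theorem, so
  \<open>LEAST\<close> picks an actual minimum there.\<close>

definition weak_gallai_ramsey :: "nat \<Rightarrow> nat \<Rightarrow> 'a ugraph \<Rightarrow> nat" where
  "weak_gallai_ramsey t s G =
     (LEAST p. \<forall>f. gallai_coloring t (complete_graph p) f \<longrightarrow>
        (\<exists>H. subgraph H (complete_graph p) \<and> graph_iso H G \<and> card (f ` edges H) \<le> s))"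

end

theory Submission
  imports Defs
begin

text \<open>Color the edges of \<open>K\<^sub>5\<close> by 1 on a 5-cycle and by 2 on its complement, keep \<open>q \<le> 5\<close> of the vertices,
  replace each of them by a block of \<open>m\<close> vertices, and give color 3 to all edges inside a block; optionally
  (\<open>w = 1\<close>) add an apex joined to everything in color 3. This is a Gallai coloring. A book in at most two
  colors avoids some color \<open>d \<in> {1, 2, 3}\<close>. If \<open>d = 3\<close>, the two spine vertices lie in different
  blocks and no page lies in either of them or at the apex, so there are at most \<open>(q - 2) m\<close> pages.
  If \<open>d \<noteq> 3\<close>, then, as every vertex of the 5-cycle has exactly two neighbors of color \<open>d\<close>, the book lives
  on the apex and three blocks, and has at most \<open>3 m + w - 2\<close> pages. For \<open>n = 3 k\<close>, \<open>3 k + 1\<close>, \<open>3 k + 2\<close>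
  take \<open>(q, m, w) = (4, k, 1)\<close>, \<open>(5, k, 1)\<close>, \<open>(4, k + 1, 0)\<close>.\<close>

text \<open>Blocks are numbered \<open>0, \<dots>, 4\<close>; the number 5 stands for the apex. The argument is the set of blocks that
  an edge meets, hence a singleton for an edge inside a block.\<close>

definition pentagon_color :: "nat set \<Rightarrow> nat" where
  "pentagon_color S =
     (if 5 \<in> S \<or> is_singleton S then 3
      else if S \<in> {{0, 1}, {1, 2}, {2, 3}, {3, 4}, {4, 0}} then 1 else 2)"

text \<open>Blocks are consecutive intervals of length \<open>m\<close>. Everything from
  \<open>q * m\<close> on goes to the apex, whose number 5 differs from all block numbers as long as
  \<open>q \<le> 5\<close>.\<close>

definition block :: "nat \<Rightarrow> nat \<Rightarrow> nat \<Rightarrow> nat" where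
  "block q m i = (if i < q * m then i div m else 5)"

definition blowup_coloring :: "nat \<Rightarrow> nat \<Rightarrow> nat set \<Rightarrow> nat" where
  "blowup_coloring q m e = pentagon_color (block q m ` e)"

section \<open>Colors between blocks\<close>

lemma pentagon_color_range: "pentagon_color S \<in> {1, 2, 3}"
  by (auto simp: pentagon_color_def)

lemma pentagon_color_eq_3_iff: "pentagon_color {a, b} = 3 \<longleftrightarrow> a = b \<or> a = 5 \<or> b = 5"
  by (auto simp: pentagon_color_def is_singleton_def)

text \<open>A rainbow would use color 3, which forces two equal indices or the apex. Equal indices
  give both edges to the third index one color, and the apex has two edges of color 3. Indices may
  repeat, since vertices of a triangle may share a block.\<close>

lemma pentagon_color_no_rainbow:
  "\<not> distinct [pentagon_color {a, b}, pentagon_color {a, c}, pentagon_color {b, c}]"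
proof
  assume d: "distinct [pentagon_color {a, b}, pentagon_color {a, c}, pentagon_color {b, c}]"
  then have "3 \<in> {pentagon_color {a, b}, pentagon_color {a, c}, pentagon_color {b, c}}"
    using pentagon_color_range[of "{a, b}"] pentagon_color_range[of "{a, c}"]
      pentagon_color_range[of "{b, c}"] by auto
  then have "a = b \<or> a = c \<or> b = c \<or> a = 5 \<or> b = 5 \<or> c = 5"
    by (auto simp: pentagon_color_eq_3_iff dest: sym)
  with d show False
    using pentagon_color_eq_3_iff[of a b] pentagon_color_eq_3_iff[of a c]
      pentagon_color_eq_3_iff[of b c]
    by (auto simp: insert_commute)
qed

text \<open>Colors 1 and 2 each form a 5-cycle on the blocks, so exactly two of the five
  \<open>j\<close> see \<open>a\<close> in color \<open>d\<close>; the other three include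
  \<open>a\<close> itself.\<close>

lemma card_pentagon_color_avoiding:
  assumes "a < 5" "d \<in> {1, 2}"
  shows "card {j. j < 5 \<and> pentagon_color {a, j} \<noteq> d} \<le> 3"
proof -
  have "{j. j < 5 \<and> pentagon_color {a, j} \<noteq> d}
      = {j \<in> {0, 1, 2, 3, 4}. pentagon_color {a, j} \<noteq> d}"
    by auto
  \<comment> \<open>As a sum of five conditionals, the cardinality can be evaluated for each of the
    five values of \<open>a\<close>.\<close>
  also have "card \<dots> = (\<Sum>j\<in>{0, 1, 2, 3, 4}. if pentagon_color {a, j} \<noteq> d then 1 else 0)"
    by (simp only: sum.inter_filter[symmetric] card_eq_sum finite.intros)
  also have "\<dots> \<le> 3"
    using assms
    by (auto simp: pentagon_color_def is_singleton_def doubleton_eq_iff less_Suc_eq numeral_eq_Suc)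
  finally show ?thesis .
qed

section \<open>Blow-up of the pentagon\<close>

lemma block_less: "i < q * m \<Longrightarrow> block q m i < q"
  by (simp add: block_def less_mult_imp_div_less)

lemma card_block_vimage:
  assumes "finite J"
  shows "card {i. i < q * m \<and> block q m i \<in> J} \<le> card J * m"
proof -
  have "{i. i < q * m \<and> block q m i \<in> J} \<subseteq> (\<Union>j\<in>J. {j * m..<j * m + m})"
  proof
    fix i assume i: "i \<in> {i. i < q * m \<and> block q m i \<in> J}"
    then have "m > 0" by (cases m) auto
    then have "i \<in> {i div m * m..<i div m * m + m}"
      by (metis atLeastLessThan_iff div_mult_mod_eq le_add1 mod_less_divisor nat_add_left_cancel_less)
    moreover have "i div m \<in> J" using i by (auto simp: block_def)
    ultimately show "i \<in> (\<Union>j\<in>J. {j * m..<j * m + m})" by blast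
  qed
  then have "card {i. i < q * m \<and> block q m i \<in> J} \<le> card (\<Union>j\<in>J. {j * m..<j * m + m})"
    using assms by (intro card_mono) auto
  also have "\<dots> \<le> (\<Sum>j\<in>J. card {j * m..<j * m + m})"
    using assms by (rule card_UN_le)
  finally show ?thesis by simp
qed

lemma blowup_coloring_pair:
  "blowup_coloring q m {x, y} = pentagon_color {block q m x, block q m y}"
  by (simp add: blowup_coloring_def)

lemma blowup_coloring_gallai:
  assumes "t \<ge> 3"
  shows "gallai_coloring t G (blowup_coloring q m)"
  unfolding gallai_coloring_def
proof
  show "edge_coloring t G (blowup_coloring q m)"
    unfolding edge_coloring_def
  proof
    fix e show "blowup_coloring q m e \<in> {1..t}"
      using pentagon_color_range[of "block q m ` e"] assms by (auto simp: blowup_coloring_def)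
  qed
  show "\<nexists>x y z. rainbow_triangle G (blowup_coloring q m) x y z"
    unfolding rainbow_triangle_def blowup_coloring_pair
    using pentagon_color_no_rainbow by blast
qed

section \<open>Pages of a book that avoids a color\<close>

text \<open>Here \<open>x\<close>, \<open>y\<close> is the spine, \<open>Z\<close> the set of pages
  and \<open>d\<close> the avoided color. The 2 subtracted in the first bound is the spine, which
  takes up two of at most \<open>3 * m + w\<close> vertices.\<close>

lemma card_pages_le:
  assumes "q \<le> 5" "w \<le> 1" and x: "x < q * m + w" and y: "y < q * m + w" and "x \<noteq> y"
    and Z: "Z \<subseteq> {..<q * m + w} - {x, y}"
    and d: "d \<in> {1, 2, 3}" "blowup_coloring q m {x, y} \<noteq> d"
      "\<And>z. z \<in> Z \<Longrightarrow> blowup_coloring q m {x, z} \<noteq> d \<and> blowup_coloring q m {y, z} \<noteq> d"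
  shows "card Z \<le> max (3 * m + w - 2) ((q - 2) * m)"
proof (cases "d = 3")
  case True
  let ?a = "block q m x" and ?b = "block q m y"
  have ab: "?a \<noteq> ?b" "?a \<noteq> 5" "?b \<noteq> 5"
    using d(2) True by (auto simp: blowup_coloring_pair pentagon_color_eq_3_iff)
  then have "?a < q" "?b < q"
    by (auto simp: block_def split: if_splits intro: less_mult_imp_div_less)
  with ab have J: "card ({..<q} - {?a, ?b}) = q - 2"
    by (subst card_Diff_subset) auto
  have "Z \<subseteq> {i. i < q * m \<and> block q m i \<in> {..<q} - {?a, ?b}}"
  proof
    fix z assume "z \<in> Z"
    with d(3)[of z] True
    have z: "block q m z \<noteq> 5" "block q m z \<noteq> ?a" "block q m z \<noteq> ?b"
      by (auto simp: blowup_coloring_pair pentagon_color_eq_3_iff)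
    then have "z < q * m" by (auto simp: block_def split: if_splits)
    with z block_less show "z \<in> {i. i < q * m \<and> block q m i \<in> {..<q} - {?a, ?b}}" by auto
  qed
  then have "card Z \<le> card {i. i < q * m \<and> block q m i \<in> {..<q} - {?a, ?b}}"
    by (intro card_mono) auto
  also have "\<dots> \<le> (q - 2) * m"
    using card_block_vimage[of "{..<q} - {?a, ?b}" q m] J by simp
  finally show ?thesis by simp
next
  case False
  with d have d12: "d \<in> {1, 2}" by auto
  \<comment> \<open>Since \<open>w \<le> 1\<close>, there is at most one apex, so some spine vertex
    lies in a block.\<close>
  have "x < q * m \<or> y < q * m"
    using x y \<open>x \<noteq> y\<close> \<open>w \<le> 1\<close> by linarith
  then obtain u where u: "u \<in> {x, y}" "u < q * m" by blast
  let ?J = "{j. j < 5 \<and> pentagon_color {block q m u, j} \<noteq> d}"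
  let ?A = "{i. i < q * m \<and> block q m i \<in> ?J} \<union> {q * m..<q * m + w}"
  have "block q m u < 5"
    using block_less[OF u(2)] \<open>q \<le> 5\<close> by simp
  note J = card_pentagon_color_avoiding[OF this d12]
  have near: "v \<in> ?A" if "v < q * m + w" "blowup_coloring q m {u, v} \<noteq> d" for v
    using that block_less[of v q m] \<open>q \<le> 5\<close> by (auto simp: blowup_coloring_pair)
  \<comment> \<open>The vertex \<open>u\<close> is itself one of \<open>x\<close>, \<open>y\<close>
    and must be counted too; its degenerate edge has color 3, hence not \<open>d\<close>.\<close>
  have self: "blowup_coloring q m {v, v} \<noteq> d" for v
    using pentagon_color_eq_3_iff[of "block q m v" "block q m v"] False
    by (simp only: blowup_coloring_pair) simp
  have "insert x (insert y Z) \<subseteq> ?A"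
  proof
    fix v assume v: "v \<in> insert x (insert y Z)"
    then have "v < q * m + w" using x y Z by auto
    moreover have "blowup_coloring q m {u, v} \<noteq> d"
      using v u(1) d(2) d(3)[of v] self[of v] insert_commute[of x y "{}"] by fastforce
    ultimately show "v \<in> ?A" by (rule near)
  qed
  then have "card (insert x (insert y Z)) \<le> card ?A"
    by (intro card_mono) auto
  also have "\<dots> \<le> card {i. i < q * m \<and> block q m i \<in> ?J} + card {q * m..<q * m + w}"
    by (rule card_Un_le)
  also have "\<dots> \<le> card ?J * m + w"
    using card_block_vimage[of ?J q m] by simp
  also have "\<dots> \<le> 3 * m + w"
    using J by simp
  finally have "card (insert x (insert y Z)) \<le> 3 * m + w" .
  moreover have "finite Z" "x \<notin> Z" "y \<notin> Z"
    using Z finite_subset by auto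
  ultimately show ?thesis
    using \<open>x \<noteq> y\<close> by simp
qed

section \<open>Copies of books\<close>

lemma book_edges:
  "{Inl 0, Inl 1} \<in> edges (book n)"
  "i < n \<Longrightarrow> j < 2 \<Longrightarrow> {Inl j, Inr i} \<in> edges (book n)"
proof -
  have "{0, 1} \<in> [{..<2::nat}]\<^bsup>2\<^esup>" by (auto simp: nsets_def)
  then have "Inl ` {0, 1} \<in> edges (book n)"
    unfolding book_def graph_join_def complete_graph_def by (auto simp del: image_insert)
  then show "{Inl 0, Inl 1} \<in> edges (book n)" by simp
qed (auto simp: book_def graph_join_def complete_graph_def empty_graph_def)

lemma verts_book: "verts (book n) = {..<2} <+> {..<n}"
  by (simp add: book_def graph_join_def complete_graph_def empty_graph_def)

lemma simple_graph_book: "simple_graph (book n)"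
proof -
  have "e \<in> [{..<2::nat} <+> {..<n}]\<^bsup>2\<^esup>" if "e \<in> edges (book n)" for e
    using that
    by (auto simp: book_def graph_join_def complete_graph_def empty_graph_def nsets_def card_image)
  then show ?thesis by (auto simp: simple_graph_def verts_book)
qed

text \<open>The inverse \<open>g\<close> of the isomorphism carries the spine and the pages of the
  abstract book to vertices of \<open>G\<close>.\<close>

lemma book_copyE:
  assumes "subgraph H G" "graph_iso H (book n)"
  obtains x y Z where "x \<in> verts G" "y \<in> verts G" "x \<noteq> y" "Z \<subseteq> verts G - {x, y}" "card Z = n"
    "{x, y} \<in> edges H" "\<And>z. z \<in> Z \<Longrightarrow> {x, z} \<in> edges H \<and> {y, z} \<in> edges H"
proof -
  obtain h where h: "bij_betw h (verts H) (verts (book n))"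
    and e: "\<forall>x\<in>verts H. \<forall>y\<in>verts H. {x, y} \<in> edges H \<longleftrightarrow> {h x, h y} \<in> edges (book n)"
    using assms(2) unfolding graph_iso_def by blast
  define g where "g = inv_into (verts H) h"
  have g: "g v \<in> verts H" "h (g v) = v" if "v \<in> verts (book n)" for v
    using that h unfolding g_def
    by (auto simp: bij_betw_def inv_into_into f_inv_into_f)
  have inj: "inj_on g (verts (book n))"
    by (metis g(2) inj_onI)
  have eg: "{g u, g v} \<in> edges H"
    if "{u, v} \<in> edges (book n)" "u \<in> verts (book n)" "v \<in> verts (book n)" for u v
    using that e g by auto
  have V: "Inl 0 \<in> verts (book n)" "Inl 1 \<in> verts (book n)" "i < n \<Longrightarrow> Inr i \<in> verts (book n)" for i
    by (auto simp: verts_book)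
  have sub: "verts H \<subseteq> verts G" using assms(1) by (simp add: subgraph_def)
  show ?thesis
  proof (rule that)
    show "g (Inl 0) \<in> verts G" "g (Inl 1) \<in> verts G" using sub g V by auto
    show "g (Inl 0) \<noteq> g (Inl 1)" using inj V by (auto dest: inj_onD)
    show "g ` Inr ` {..<n} \<subseteq> verts G - {g (Inl 0), g (Inl 1)}"
      using sub g V inj by (auto dest: inj_onD)
    show "card (g ` Inr ` {..<n}) = n"
      using V inj by (subst card_image) (auto simp: card_image intro: inj_on_subset)
    show "{g (Inl 0), g (Inl 1)} \<in> edges H"
      by (intro eg book_edges V)
    show "{g (Inl 0), z} \<in> edges H \<and> {g (Inl 1), z} \<in> edges H" if "z \<in> g ` Inr ` {..<n}" for z
      using that by (auto simp del: One_nat_def intro!: eg book_edges V)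
  qed
qed

section \<open>Existence of the Ramsey number\<close>

lemma graph_copy_in_clique:
  assumes G: "simple_graph G" and "finite (verts G)" "card (verts G) = card S" "finite S"
    and S: "S \<subseteq> {..<p}"
  obtains H where "subgraph H (complete_graph p)" "graph_iso H G" "edges H \<subseteq> [S]\<^bsup>2\<^esup>"
proof -
  obtain g where g: "bij_betw g (verts G) S"
    using assms finite_same_card_bij by blast
  define H where "H = \<lparr>verts = S, edges = image g ` edges G\<rparr>"
  have E: "edges H \<subseteq> [S]\<^bsup>2\<^esup>"
  proof
    fix e assume "e \<in> edges H"
    then obtain e' where "e = g ` e'" "e' \<in> [verts G]\<^bsup>2\<^esup>"
      using G by (auto simp: H_def simple_graph_def)
    then show "e \<in> [S]\<^bsup>2\<^esup>"
      using g by (auto simp: nsets_def bij_betw_def card_image inj_on_subset)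
  qed
  moreover have "[S]\<^bsup>2\<^esup> \<subseteq> [{..<p}]\<^bsup>2\<^esup>"
    using S by (rule nsets_mono)
  ultimately have "subgraph H (complete_graph p)"
    using S by (auto simp: subgraph_def simple_graph_def complete_graph_def H_def)
  moreover have "graph_iso H G"
    unfolding graph_iso_def
  proof (intro exI conjI ballI)
    let ?h = "inv_into (verts G) g"
    show "bij_betw ?h (verts H) (verts G)"
      using g by (simp add: H_def bij_betw_inv_into)
    fix x y assume xy: "x \<in> verts H" "y \<in> verts H"
    then have h: "?h x \<in> verts G" "?h y \<in> verts G" "g (?h x) = x" "g (?h y) = y"
      using g by (auto simp: H_def bij_betw_def inv_into_into f_inv_into_f)
    show "{x, y} \<in> edges H \<longleftrightarrow> {?h x, ?h y} \<in> edges G"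
    proof
      assume "{x, y} \<in> edges H"
      then obtain e where e: "e \<in> edges G" "g ` {?h x, ?h y} = g ` e"
        using h by (auto simp: H_def)
      moreover have "e \<subseteq> verts G" using e(1) G by (auto simp: simple_graph_def nsets_def)
      ultimately have "{?h x, ?h y} = e"
        using g h by (metis bij_betw_def empty_subsetI inj_on_image_eq_iff insert_subset)
      with e show "{?h x, ?h y} \<in> edges G" by simp
    next
      assume "{?h x, ?h y} \<in> edges G"
      then have "g ` {?h x, ?h y} \<in> edges H" unfolding H_def by (auto simp del: image_insert)
      then show "{x, y} \<in> edges H" using h by simp
    qed
  qed
  ultimately show ?thesis using that E by blast
qed

text \<open>The \<open>LEAST\<close> has its property once some \<open>p\<close> does. Ramsey's
  theorem gives a monochromatic clique on \<open>card (verts G)\<close> vertices, and a copy of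
  \<open>G\<close> inside it uses at most one color.\<close>

lemma weak_gallai_ramsey_attained:
  assumes G: "simple_graph G" "finite (verts G)" and "s \<ge> 1"
    and f: "gallai_coloring t (complete_graph (weak_gallai_ramsey t s G)) f"
  shows "\<exists>H. subgraph H (complete_graph (weak_gallai_ramsey t s G)) \<and> graph_iso H G
    \<and> card (f ` edges H) \<le> s"
proof -
  let ?P = "\<lambda>p. \<forall>f. gallai_coloring t (complete_graph p) f \<longrightarrow>
        (\<exists>H. subgraph H (complete_graph p) \<and> graph_iso H G \<and> card (f ` edges H) \<le> s)"
  \<comment> \<open>Ramsey's theorem numbers colors from 0, so \<open>Suc t\<close> of them cover
    \<open>{1..t}\<close>.\<close>
  obtain N where N: "partn_lst {..<N::nat} (replicate (Suc t) (card (verts G))) 2"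
    using ramsey_full by blast
  have "?P N"
  proof (intro allI impI)
    fix f assume "gallai_coloring t (complete_graph N) f"
    then have "f \<in> [{..<N}]\<^bsup>2\<^esup> \<rightarrow> {..<Suc t}"
      by (fastforce simp: gallai_coloring_def edge_coloring_def complete_graph_def Pi_iff less_Suc_eq_le)
    with N obtain i S where S: "S \<in> [{..<N}]\<^bsup>card (verts G)\<^esup>" and i: "f ` [S]\<^bsup>2\<^esup> \<subseteq> {i}"
      unfolding partn_lst_def monochromatic_def by (auto simp del: replicate_Suc)
    obtain H where H: "subgraph H (complete_graph N)" "graph_iso H G" "edges H \<subseteq> [S]\<^bsup>2\<^esup>"
      using graph_copy_in_clique[of G S N] G S by (auto simp: nsets_def)
    then have "f ` edges H \<subseteq> {i}" using i by blast
    then have "card (f ` edges H) \<le> card {i}" by (intro card_mono) auto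
    with H \<open>s \<ge> 1\<close> show "\<exists>H. subgraph H (complete_graph N) \<and> graph_iso H G \<and> card (f ` edges H) \<le> s"
      by auto
  qed
  then have "?P (weak_gallai_ramsey t s G)"
    unfolding weak_gallai_ramsey_def by (rule LeastI)
  with f show ?thesis by blast
qed

section \<open>The lower bound\<close>

text \<open>Otherwise the blow-up coloring, restricted to as many vertices as the Ramsey number
  says, would contain a book in two colors with more pages than \<open>card_pages_le\<close>
  allows.\<close>

lemma weak_gallai_ramsey_book_greater:
  assumes "t \<ge> 3" "q \<le> 5" "w \<le> 1" and n: "3 * m + w - 2 < n" "(q - 2) * m < n"
  shows "q * m + w < weak_gallai_ramsey t 2 (book n)"
proof (rule ccontr)
  assume "\<not> ?thesis"
  then have le: "weak_gallai_ramsey t 2 (book n) \<le> q * m + w" by simp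
  let ?K = "complete_graph (weak_gallai_ramsey t 2 (book n))" and ?f = "blowup_coloring q m"
  have "finite (verts (book n))" by (simp add: verts_book)
  then obtain H where H: "subgraph H ?K" "graph_iso H (book n)" "card (?f ` edges H) \<le> 2"
    using weak_gallai_ramsey_attained[OF simple_graph_book, of n 2 t ?f]
      blowup_coloring_gallai[OF \<open>t \<ge> 3\<close>] by auto
  have V: "verts ?K \<subseteq> {..<q * m + w}" using le by (auto simp: complete_graph_def)
  \<comment> \<open>Finiteness is needed because \<open>card\<close> of an infinite set is 0, so the
    bound 2 alone would not exclude three colors.\<close>
  have "edges H \<subseteq> Pow (verts ?K)"
    using H(1) by (auto simp: subgraph_def simple_graph_def nsets_def)
  then have "finite (edges H)"
    by (rule finite_subset) (simp add: complete_graph_def)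
  then have "\<not> {1, 2, 3} \<subseteq> ?f ` edges H"
    using H(3) card_mono[of "?f ` edges H" "{1, 2, 3}"] by auto
  then obtain d where d: "d \<in> {1, 2, 3}" "d \<notin> ?f ` edges H" by blast
  obtain x y Z where xyZ: "x \<in> verts ?K" "y \<in> verts ?K" "x \<noteq> y" "Z \<subseteq> verts ?K - {x, y}"
      "card Z = n" "{x, y} \<in> edges H" "\<And>z. z \<in> Z \<Longrightarrow> {x, z} \<in> edges H \<and> {y, z} \<in> edges H"
    using book_copyE[OF H(1,2)] by metis
  have "card Z \<le> max (3 * m + w - 2) ((q - 2) * m)"
  proof (rule card_pages_le[OF \<open>q \<le> 5\<close> \<open>w \<le> 1\<close> _ _ \<open>x \<noteq> y\<close> _ d(1)])
    show "x < q * m + w" "y < q * m + w" "Z \<subseteq> {..<q * m + w} - {x, y}"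
      using xyZ V by auto
    show "?f {x, y} \<noteq> d" using xyZ d by blast
    show "?f {x, z} \<noteq> d \<and> ?f {y, z} \<noteq> d" if "z \<in> Z" for z
      using xyZ(7)[OF that] d by blast
  qed
  with n \<open>card Z = n\<close> show False by simp
qed

theorem theorem2p6:
  fixes t n :: nat
  assumes "t \<ge> 3" and "n \<ge> 3"
  shows "real (weak_gallai_ramsey t 2 (book n)) \<ge>
           (if n mod 3 = 0 then (4 * real n + 6) / 3
            else if n mod 3 = 1 then (5 * real n + 1) / 3
            else (4 * real n + 7) / 3)"
proof -
  define k where "k = n div 3"
  have n: "n = 3 * k + n mod 3" and "k \<ge> 1" using \<open>n \<ge> 3\<close> by (auto simp: k_def)
  consider "n mod 3 = 0" | "n mod 3 = 1" | "n mod 3 = 2" by linarith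
  then show ?thesis
  proof cases
    case 1
    with n have "n = 3 * k" by simp
    \<comment> \<open>The strict inequality gives at least \<open>4 * k + 2\<close>, which equals
      \<open>(4 * n + 6) / 3\<close>; the other two cases are equally exact.\<close>
    with \<open>k \<ge> 1\<close> have "4 * k + 1 < weak_gallai_ramsey t 2 (book n)"
      by (intro weak_gallai_ramsey_book_greater \<open>t \<ge> 3\<close>) auto
    with 1 \<open>n = 3 * k\<close> show ?thesis by simp
  next
    case 2
    with n have "n = 3 * k + 1" by simp
    with \<open>k \<ge> 1\<close> have "5 * k + 1 < weak_gallai_ramsey t 2 (book n)"
      by (intro weak_gallai_ramsey_book_greater \<open>t \<ge> 3\<close>) auto
    with 2 \<open>n = 3 * k + 1\<close> show ?thesis by simp
  next
    case 3
    with n have "n = 3 * k + 2" by simp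
    \<comment> \<open>The \<open>+ 0\<close> spells out \<open>w = 0\<close>, so that the goal
      matches \<open>q * m + w\<close>.\<close>
    with \<open>k \<ge> 1\<close> have "4 * (k + 1) + 0 < weak_gallai_ramsey t 2 (book n)"
      by (intro weak_gallai_ramsey_book_greater \<open>t \<ge> 3\<close>) auto
    with 3 \<open>n = 3 * k + 2\<close> show ?thesis by simp
  qed
qed

end
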